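(* Let $0<r<s$, and put $r'=\inf\{\|u\|_\infty: u\in H,\ \mu(u)\ge r\}$ and $s'=\sup\{\|u\|_\infty: u\in H,\ \mu(u)\le s\}$. Assume that (1) $\limsup_{|t|\to\infty}\frac{F(k,t)}{|t|^{p^-}}\le0$ for every $k\in[1,T]$; (2) $\sum_{k=1}^{T}\sup_{|t|\le s'}F(k,t)<\sum_{k=1}^{T}\sup_{t\in\mathbb{R}}F(k,t)$; (3) $\sup_{r'\le|t|\le s'}F(k,t)\le-\sum_{h\in[1,T],\,h\ne k}\ \sup_{|t|\le s'}F(h,t)$ for every $k\in[1,T]$. Then there exists $\lambda^\star>0$ such that the functional $E_{\lambda^\star}$ has at least three critical points in $H$, two of which must be nontrivial (i.e. different from $0$).
   Context: $T\ge1$ is an integer; for integers $a<b$, $[a,b]$ denotes the discrete interval $\{a,a+1,\dots,b\}$ (with $[1,1]=\{1\}$). $p:[0,T+1]\to(0,\infty)$ satisfies $p^->1$, where $p^-=\min_{k\in[0,T+1]}p(k)$ and $p^+=\max_{k\in[0,T+1]}p(k)$. $f:[1,T]\times\mathbb{R}\to\mathbb{R}$ is continuous in its second variable and $F(k,t)=\int_0^t f(k,\tau)\,d\tau$. $\Delta u(k-1)=u(k)-u(k-1)$. $H=\{u:[0,T+1]\to\mathbb{R}:u(0)=u(T+1)=0\}$ with norm $\|u\|=\big(\sum_{k=1}^{T+1}|\Delta u(k-1)|^2\big)^{1/2}$, and $\|u\|_\infty=\max_{k}|u(k)|$. For $u\in H$, $$\mu(u)=\sum_{k=1}^{T+1}\frac1{p(k-1)}|\Delta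 u(k-1)|^{p(k-1)},\qquad J(u)=-\sum_{k=1}^{T}F(k,u(k)),\qquad E_\lambda(u)=\mu(u)+\lambda J(u).$$ Suprema over $\mathbb{R}$ may equal $+\infty$. *)

theory Defs
  imports "HOL-Analysis.Analysis"
begin

text \<open>A function on the discrete interval \<open>[0, T+1]\<close> that vanishes at both end points is
  represented by its extension by zero to \<^typ>\<open>nat\<close>; this makes equality of representatives the
  same as equality on \<open>[0, T+1]\<close> and makes the vector operations pointwise.\<close>

definition H :: "nat \<Rightarrow> (nat \<Rightarrow> real) set" where
  "H T = {u. u 0 = 0 \<and> u (T + 1) = 0 \<and> (\<forall>k. k \<notin> {0..T + 1} \<longrightarrow> u k = 0)}"

definition fdiff :: "(nat \<Rightarrow> real) \<Rightarrow> nat \<Rightarrow> real" where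
  "fdiff u k = u (k + 1) - u k"

definition normH :: "nat \<Rightarrow> (nat \<Rightarrow> real) \<Rightarrow> real" where
  "normH T u = sqrt (\<Sum>k=1..T + 1. \<bar>fdiff u (k - 1)\<bar>\<^sup>2)"

definition norm_sup :: "nat \<Rightarrow> (nat \<Rightarrow> real) \<Rightarrow> real" where
  "norm_sup T u = Max ((\<lambda>k. \<bar>u k\<bar>) ` {0..T + 1})"

definition p_min :: "nat \<Rightarrow> (nat \<Rightarrow> real) \<Rightarrow> real" where
  "p_min T p = Min (p ` {0..T + 1})"

text \<open>The interval integral is oriented, so this is also the intended primitive for \<open>t < 0\<close>.\<close>

definition primitive :: "(nat \<Rightarrow> real \<Rightarrow> real) \<Rightarrow> nat \<Rightarrow> real \<Rightarrow> real" where
  "primitive f k t = (LBINT \<tau>=ereal 0..ereal t. f k \<tau>)"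

definition mu :: "nat \<Rightarrow> (nat \<Rightarrow> real) \<Rightarrow> (nat \<Rightarrow> real) \<Rightarrow> real" where
  "mu T p u = (\<Sum>k=1..T + 1. 1 / p (k - 1) * \<bar>fdiff u (k - 1)\<bar> powr p (k - 1))"

definition J :: "nat \<Rightarrow> (nat \<Rightarrow> real \<Rightarrow> real) \<Rightarrow> (nat \<Rightarrow> real) \<Rightarrow> real" where
  "J T f u = - (\<Sum>k=1..T. primitive f k (u k))"

definition energy ::
  "nat \<Rightarrow> (nat \<Rightarrow> real) \<Rightarrow> (nat \<Rightarrow> real \<Rightarrow> real) \<Rightarrow> real \<Rightarrow> (nat \<Rightarrow> real) \<Rightarrow> real" where
  "energy T p f lam u = mu T p u + lam * J T f u"

text \<open>For \<open>T \<ge> 1\<close> and \<open>p > 0\<close> the two sets of reals below are nonempty and respectively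
  bounded below and (since \<open>\<mu>\<close> is coercive) bounded above, so the real infimum and supremum are
  the genuine ones.\<close>

definition inf_radius :: "nat \<Rightarrow> (nat \<Rightarrow> real) \<Rightarrow> real \<Rightarrow> real" where
  "inf_radius T p r = Inf {norm_sup T u |u. u \<in> H T \<and> mu T p u \<ge> r}"

definition sup_radius :: "nat \<Rightarrow> (nat \<Rightarrow> real) \<Rightarrow> real \<Rightarrow> real" where
  "sup_radius T p s = Sup {norm_sup T u |u. u \<in> H T \<and> mu T p u \<le> s}"

text \<open>Frechet differentiability on the normed space \<open>(H, normH)\<close>; since \<^term>\<open>H T\<close> is not a type,
  the library's \<^const>\<open>has_derivative\<close> cannot be used and its definition is relativised to the
  carrier.\<close>

definition has_derivative_H ::
  "nat \<Rightarrow> ((nat \<Rightarrow> real) \<Rightarrow> real) \<Rightarrow> ((nat \<Rightarrow> real) \<Rightarrow> real) \<Rightarrow> (nat \<Rightarrow> real) \<Rightarrow> bool" where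
  "has_derivative_H T E E' u \<longleftrightarrow>
     (\<forall>v\<in>H T. \<forall>w\<in>H T. E' (\<lambda>k. v k + w k) = E' v + E' w) \<and>
     (\<forall>a. \<forall>v\<in>H T. E' (\<lambda>k. a * v k) = a * E' v) \<and>
     (\<exists>C. \<forall>v\<in>H T. \<bar>E' v\<bar> \<le> C * normH T v) \<and>
     (\<forall>e>0. \<exists>d>0. \<forall>v\<in>H T. normH T v < d \<longrightarrow>
        \<bar>E (\<lambda>k. u k + v k) - E u - E' v\<bar> \<le> e * normH T v)"

definition critical_point :: "nat \<Rightarrow> ((nat \<Rightarrow> real) \<Rightarrow> real) \<Rightarrow> (nat \<Rightarrow> real) \<Rightarrow> bool" where
  "critical_point T E u \<longleftrightarrow>
     u \<in> H T \<and> (\<exists>E'. has_derivative_H T E E' u \<and> (\<forall>v\<in>H T. E' v = 0))"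

end

theory Submission
  imports Defs
begin

text \<open>
  Call \<open>r \<le> \<mu> u \<le> s\<close> the annulus. Some coordinate \<open>k\<close> of a point \<open>u\<close> of the annulus carries its
  sup-norm, which lies between \<open>r'\<close> and \<open>s'\<close>, while all other coordinates are bounded by \<open>s'\<close>.
  The bound on \<open>F k\<close> over \<open>r' \<le> \<bar>t\<bar> \<le> s'\<close> by the negated sum of the other suprema therefore gives
  \<open>\<Sum>\<^sub>h F h (u h) \<le> 0\<close>, that is \<open>J u \<ge> 0\<close>, and so \<open>E\<^sub>\<lambda> u \<ge> \<mu> u \<ge> r > 0\<close> for every
  \<open>\<lambda> > 0\<close>: the annulus is a potential barrier, and its height does not depend on \<open>\<lambda>\<close>. Inside it lies
  \<open>0\<close>, where \<open>E\<^sub>\<lambda>\<close> vanishes.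

  The parameter \<open>\<lambda>\<close> is chosen to make the two sides of the barrier equally deep. Let \<open>a(\<lambda>)\<close> be the
  infimum of \<open>E\<^sub>\<lambda>\<close> over \<open>\<mu> \<le> r\<close> and \<open>b(\<lambda>)\<close> the infimum over \<open>\<mu> \<ge> s\<close>. For small \<open>\<lambda>\<close> the term \<open>\<mu>\<close>
  dominates and \<open>a(\<lambda>) \<le> 0 \<le> b(\<lambda>)\<close>. By the strict inequality between the two sums of suprema, \<open>J\<close>
  takes values outside the barrier below its infimum over \<open>\<mu> \<le> s\<close>, so \<open>b(\<lambda>) \<le> a(\<lambda>)\<close> for large
  \<open>\<lambda>\<close>. As infima of affine functions of \<open>\<lambda>\<close>, both are concave, hence continuous, and they agree at
  some \<open>\<lambda>\<^sup>\<star>\<close> (lemma \<open>infima_cross\<close>). By the limsup condition \<open>\<lambda> J\<close> cannot outweigh \<open>\<mu>\<close> at infinity,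
  so the energy is coercive (lemma \<open>coercive\<close>) and both infima are attained. Since the common value
  is at most \<open>0\<close>, hence below the barrier, the two minimisers \<open>u\<^sub>1\<close> (inside) and \<open>u\<^sub>2\<close> (outside) are
  global minimisers and critical points.

  The third critical point \<open>u\<^sub>3\<close> comes from the lemma \<open>mountain_pass\<close>: any connected set joining \<open>u\<^sub>1\<close> to
  \<open>u\<^sub>2\<close> meets \<open>\<mu> = r\<close>, so there is a critical point of energy at least \<open>r > 0\<close>. It differs from \<open>0\<close>,
  \<open>u\<^sub>1\<close> and \<open>u\<^sub>2\<close>, whose energies are at most \<open>0\<close>. Since also \<open>u\<^sub>2 \<noteq> 0\<close>, the nontrivial pair is
  \<open>u\<^sub>2, u\<^sub>3\<close>.

  All topology takes place in the product topology of \<^typ>\<open>nat \<Rightarrow> real\<close>. On functions supported in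
  a fixed finite set it is the Euclidean one, and it is metrizable, so uniform continuity on compact
  sets is at hand although the dimension \<open>T\<close> is a variable.
\<close>

section \<open>A mountain pass lemma in finitely many variables\<close>

lemma directional_derivative_along_line:
  fixes E :: "('i \<Rightarrow> real) \<Rightarrow> real"
  assumes deriv: "\<And>u v. u \<in> V \<Longrightarrow> v \<in> V \<Longrightarrow>
      ((\<lambda>t. E (\<lambda>k. u k + t * v k)) has_real_derivative (\<Sum>k\<in>I. G u k * v k)) (at 0)"
    and V: "V = {u. \<forall>k. k \<notin> I \<longrightarrow> u k = 0}"
    and u: "u \<in> V" and v: "v \<in> V"
  shows "((\<lambda>t. E (\<lambda>k. u k + t * v k)) has_real_derivative
           (\<Sum>k\<in>I. G (\<lambda>k. u k + t * v k) k * v k)) (at t)"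
proof -
  let ?w = "\<lambda>k. u k + t * v k"
  have w: "?w \<in> V" using u v by (auto simp: V)
  have "((\<lambda>h. E (\<lambda>k. ?w k + h * v k)) has_real_derivative (\<Sum>k\<in>I. G ?w k * v k)) (at 0)"
    by (rule deriv[OF w v])
  then have "((\<lambda>h. E (\<lambda>k. u k + (h + t) * v k)) has_real_derivative (\<Sum>k\<in>I. G ?w k * v k)) (at 0)"
    by (simp add: algebra_simps)
  then show ?thesis
    using DERIV_shift[of "\<lambda>t. E (\<lambda>k. u k + t * v k)" "\<Sum>k\<in>I. G ?w k * v k" 0 t] by simp
qed

text \<open>
  Functions supported in a finite set \<open>I\<close> stand for a Euclidean space of arbitrary dimension, and \<open>G\<close>
  is the gradient of \<open>E\<close>. The pass level \<open>c\<close> is the infimum of the levels \<open>a\<close> such that \<open>u1\<close> and \<open>u2\<close>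
  lie in a connected subset of \<open>{E \<le> a}\<close>; the barrier gives \<open>\<rho> \<le> c\<close>. If \<open>c\<close> were not critical, compactness of the sublevel sets
  would give one step size \<open>\<tau>\<close> for which a single explicit gradient step \<open>u \<mapsto> u - \<tau> G u\<close> pushes
  every nearly optimal connecting set strictly below \<open>c\<close>. The step is continuous, hence preserves
  connectedness, and it fixes \<open>u1\<close> and \<open>u2\<close> because these are critical; so the pushed set still
  connects them, a contradiction.
\<close>

lemma mountain_pass:
  fixes E :: "('i::countable \<Rightarrow> real) \<Rightarrow> real"
  assumes I: "finite I"
    and V: "V = {u. \<forall>k. k \<notin> I \<longrightarrow> u k = 0}"
    and deriv: "\<And>u v. u \<in> V \<Longrightarrow> v \<in> V \<Longrightarrow>
      ((\<lambda>t. E (\<lambda>k. u k + t * v k)) has_real_derivative (\<Sum>k\<in>I. G u k * v k)) (at 0)"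
    and contG: "\<And>k. k \<in> I \<Longrightarrow> continuous_on V (\<lambda>u. G u k)"
    and contE: "continuous_on V E"
    and cpt: "\<And>a. compact {u \<in> V. E u \<le> a}"
    and u1: "u1 \<in> V" "\<And>k. k \<in> I \<Longrightarrow> G u1 k = 0"
    and u2: "u2 \<in> V" "\<And>k. k \<in> I \<Longrightarrow> G u2 k = 0"
    and barrier: "\<And>S. connected S \<Longrightarrow> S \<subseteq> V \<Longrightarrow> u1 \<in> S \<Longrightarrow> u2 \<in> S \<Longrightarrow> \<exists>u\<in>S. \<rho> \<le> E u"
  shows "\<exists>u\<in>V. (\<forall>k\<in>I. G u k = 0) \<and> \<rho> \<le> E u"
proof (rule ccontr)
  assume none: "\<not> ?thesis"
  define links where "links S \<longleftrightarrow> connected S \<and> S \<subseteq> V \<and> u1 \<in> S \<and> u2 \<in> S" for S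
  define L where "L = {a. \<exists>S. links S \<and> (\<forall>u\<in>S. E u \<le> a)}"
  define c where "c = Inf L"
  have \<rho>L: "\<rho> \<le> a" if a: "a \<in> L" for a
  proof -
    obtain S where S: "links S" "\<forall>u\<in>S. E u \<le> a"
      using a unfolding L_def by blast
    then obtain u where "u \<in> S" "\<rho> \<le> E u" using barrier unfolding links_def by meson
    then show ?thesis using S(2) by (meson order_trans)
  qed
  have L_ne: "L \<noteq> {}"
  proof -
    let ?seg = "\<lambda>t k. u1 k + t * (u2 k - u1 k)"
    let ?S = "?seg ` {0..1}"
    have cont: "continuous_on {0..1} ?seg"
      by (intro continuous_intros)
    have sub: "?S \<subseteq> V" using u1(1) u2(1) by (auto simp: V)
    have "compact (E ` ?S)"
      using cont sub contE
      by (intro compact_continuous_image) (auto intro: continuous_on_subset)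
    then have "bdd_above (E ` ?S)"
      by (intro bounded_imp_bdd_above compact_imp_bounded)
    then obtain a where "\<forall>u\<in>?S. E u \<le> a"
      unfolding bdd_above_def by blast
    moreover have "connected ?S" by (rule connected_continuous_image[OF cont]) simp
    moreover have "?seg 0 \<in> ?S" "?seg 1 \<in> ?S" by (rule imageI, simp)+
    ultimately have "links ?S" using sub by (auto simp: links_def)
    then have "a \<in> L" unfolding L_def using \<open>\<forall>u\<in>?S. E u \<le> a\<close> by blast
    then show ?thesis by blast
  qed
  have bdd: "bdd_below L" using \<rho>L by (auto simp: bdd_below_def)
  have c_le: "c \<le> a" if "a \<in> L" for a
    unfolding c_def using that bdd by (rule cInf_lower)
  have \<rho>c: "\<rho> \<le> c" unfolding c_def using L_ne \<rho>L by (rule cInf_greatest)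
  define M where "M = {u \<in> V. E u \<le> c + 1}"
  have cptM: "compact M" unfolding M_def by (rule cpt)
  have MV: "M \<subseteq> V" by (auto simp: M_def)
  define N where "N u = (\<Sum>k\<in>I. (G u k)\<^sup>2)" for u
  have contN: "continuous_on V N"
    unfolding N_def by (intro continuous_intros contG)
  \<comment> \<open>One positive bound covers both regions of the sublevel set: near the level \<open>c\<close> the gradient is
    bounded away from \<open>0\<close>, elsewhere the energy is bounded away from \<open>c\<close>.\<close>
  obtain m where m: "m > 0" "\<And>u. u \<in> M \<Longrightarrow> m \<le> N u + \<bar>E u - c\<bar>"
  proof -
    obtain a where "a \<in> L" "a < c + 1"
      using cInf_lessD[OF L_ne, of "c + 1"] by (auto simp: c_def)
    then have "u1 \<in> M" using u1(1) by (fastforce simp: L_def M_def links_def)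
    then have "M \<noteq> {}" by blast
    moreover have "continuous_on M (\<lambda>u. N u + \<bar>E u - c\<bar>)"
      by (intro continuous_intros continuous_on_subset[OF contN MV] continuous_on_subset[OF contE MV])
    ultimately obtain x where x: "x \<in> M" "\<And>u. u \<in> M \<Longrightarrow> N x + \<bar>E x - c\<bar> \<le> N u + \<bar>E u - c\<bar>"
      using continuous_attains_inf[OF cptM, of "\<lambda>u. N u + \<bar>E u - c\<bar>"] by blast
    have Nx: "0 \<le> N x" unfolding N_def by (simp add: sum_nonneg)
    have "N x + \<bar>E x - c\<bar> > 0"
    proof (rule ccontr)
      assume "\<not> ?thesis"
      then have "N x = 0" "E x = c" using Nx by linarith+
      then have "\<forall>k\<in>I. G x k = 0" using I by (simp add: N_def sum_nonneg_eq_0_iff)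
      then show False using none x(1) \<rho>c \<open>E x = c\<close> MV by auto
    qed
    then show thesis using that x(2) by blast
  qed
  define g where "g u = (\<lambda>k. if k \<in> I then - G u k else 0)" for u
  have gV: "g u \<in> V" for u by (auto simp: g_def V)
  define flow where "flow z = (\<lambda>k. snd z k + fst z * g (snd z) k)" for z :: "real \<times> ('i \<Rightarrow> real)"
  have flowV: "flow (t, u) \<in> V" if "u \<in> V" for t u
    using that gV[of u] by (auto simp: flow_def V)
  have contg: "continuous_on V g"
    unfolding g_def
  proof (rule continuous_on_coordinatewise_then_product)
    fix i
    show "continuous_on V (\<lambda>u. if i \<in> I then - G u i else 0)"
      by (cases "i \<in> I") (auto intro!: continuous_on_minus contG)
  qed
  have cont_flow: "continuous_on ({0..1} \<times> V) flow"
    unfolding flow_def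
  proof (intro continuous_intros continuous_on_coordinatewise_then_product)
    fix i
    show "continuous_on ({0..1} \<times> V) (\<lambda>z. snd z i)"
      by (rule continuous_on_product_then_coordinatewise) (intro continuous_intros)
    have "continuous_on ({0..1} \<times> V) (\<lambda>z. g (snd z))"
      by (rule continuous_on_compose2[OF contg]) (auto intro: continuous_intros)
    then show "continuous_on ({0..1} \<times> V) (\<lambda>z. g (snd z) i)"
      by (rule continuous_on_product_then_coordinatewise)
  qed
  \<comment> \<open>Minus the derivative of \<open>E\<close> along the step at time \<open>t\<close>; at \<open>t = 0\<close> it is the squared gradient
    norm, and uniform continuity keeps it close to that for all short times at once.\<close>
  define Q where "Q z = (\<Sum>k\<in>I. G (flow z) k * G (snd z) k)" for z
  have contQ: "continuous_on ({0..1} \<times> V) Q"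
    unfolding Q_def
  proof (intro continuous_intros)
    fix k assume k: "k \<in> I"
    show "continuous_on ({0..1} \<times> V) (\<lambda>z. G (flow z) k)"
      by (rule continuous_on_compose2[OF contG[OF k] cont_flow]) (use flowV in auto)
    show "continuous_on ({0..1} \<times> V) (\<lambda>z. G (snd z) k)"
      by (rule continuous_on_compose2[OF contG[OF k]]) (auto intro: continuous_intros)
  qed
  have "uniformly_continuous_on ({0..1} \<times> M) Q"
    using MV cptM
    by (intro compact_uniformly_continuous compact_Times continuous_on_subset[OF contQ]) auto
  then obtain d where d: "d > 0" "\<And>z z'. z \<in> {0..1} \<times> M \<Longrightarrow> z' \<in> {0..1} \<times> M \<Longrightarrow> dist z' z < d \<Longrightarrow>
      dist (Q z') (Q z) < m / 4"
    using m(1) uniformly_continuous_onE[of _ Q "m / 4"] by (metis divide_pos_pos zero_less_numeral)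
  define \<tau> where "\<tau> = min (d / 2) 1"
  have \<tau>: "0 < \<tau>" "\<tau> \<le> 1" "\<tau> < d" using d(1) by (auto simp: \<tau>_def)
  have Q0: "Q (0, u) = N u" for u
    by (simp add: Q_def N_def flow_def power2_eq_square)
  have Qlow: "N u - m / 4 \<le> Q (t, u)" if "u \<in> M" "0 \<le> t" "t \<le> \<tau>" for u t
  proof -
    have "dist (Q (t, u)) (Q (0, u)) < m / 4"
      by (rule d(2)) (use that \<tau> in \<open>auto simp: dist_Pair_Pair\<close>)
    then show ?thesis unfolding Q0 dist_real_def by linarith
  qed
  \<comment> \<open>With the error \<open>m / 4\<close>, the step gains at least \<open>\<tau> m / 4\<close> where \<open>N u \<ge> m / 2\<close>, and loses at most
    \<open>\<tau> m / 4\<close> where \<open>E u \<le> c - m / 2\<close>; starting below \<open>c + \<tau> m / 8\<close> both end below \<open>c\<close>.\<close>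
  have descent: "E (flow (\<tau>, u)) \<le> E u - \<tau> * (N u - m / 4)" if u: "u \<in> M" for u
  proof -
    have uV: "u \<in> V" using u MV by blast
    have der: "((\<lambda>t. E (flow (t, u))) has_real_derivative - Q (t, u)) (at t)" for t
    proof -
      have "((\<lambda>t. E (\<lambda>k. u k + t * g u k)) has_real_derivative
          (\<Sum>k\<in>I. G (\<lambda>k. u k + t * g u k) k * g u k)) (at t)"
        by (rule directional_derivative_along_line[OF _ V uV gV]) (rule deriv)
      moreover have "(\<Sum>k\<in>I. G (\<lambda>k. u k + t * g u k) k * g u k) = - Q (t, u)"
        unfolding Q_def sum_negf[symmetric] by (intro sum.cong) (auto simp: flow_def g_def)
      ultimately show ?thesis by (simp add: flow_def)
    qed
    obtain t where t: "0 < t" "t < \<tau>" "E (flow (\<tau>, u)) - E (flow (0, u)) = (\<tau> - 0) * - Q (t, u)"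
      using MVT2[OF \<tau>(1) der] by blast
    have "\<tau> * (N u - m / 4) \<le> \<tau> * Q (t, u)"
      using Qlow[OF u, of t] t \<tau> by (intro mult_left_mono) auto
    moreover have "flow (0, u) = u" by (simp add: flow_def)
    ultimately show ?thesis using t(3) by simp
  qed
  have "0 < \<tau> * m / 8" using \<tau> m(1) by simp
  then obtain a where a: "a \<in> L" "a < c + \<tau> * m / 8" "a < c + 1"
    using cInf_lessD[OF L_ne, of "c + min (\<tau> * m / 8) 1"] by (auto simp: c_def)
  then obtain S where "links S" and Sa: "\<And>u. u \<in> S \<Longrightarrow> E u \<le> a"
    unfolding L_def by blast
  then have S: "connected S" "S \<subseteq> V" "u1 \<in> S" "u2 \<in> S" by (auto simp: links_def)
  let ?S = "(\<lambda>u. flow (\<tau>, u)) ` S"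
  have "connected ?S"
    using S \<tau>
    by (intro connected_continuous_image continuous_on_compose2[OF cont_flow] continuous_intros) auto
  moreover have "?S \<subseteq> V" using S flowV by auto
  moreover have "flow (\<tau>, u1) = u1" "flow (\<tau>, u2) = u2"
    using u1 u2 by (auto simp: flow_def g_def fun_eq_iff)
  then have "u1 \<in> ?S" "u2 \<in> ?S" using S(3,4) by (metis imageI)+
  ultimately have "links ?S" by (simp add: links_def)
  moreover have "E (flow (\<tau>, u)) \<le> c - \<tau> * m / 8" if u: "u \<in> S" for u
  proof -
    have Eu: "E u < c + \<tau> * m / 8" "E u < c + 1" using Sa[OF u] a by auto
    then have uM: "u \<in> M" using u S(2) by (auto simp: M_def)
    have tm: "\<tau> * m \<le> m" using \<tau> m(1) by (simp add: mult_left_le_one_le)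
    have N0: "0 \<le> \<tau> * N u" using \<tau> unfolding N_def by (simp add: sum_nonneg)
    show ?thesis
    proof (cases "\<bar>E u - c\<bar> < m / 2")
      case True
      then have "m / 2 \<le> N u" using m(2)[OF uM] by linarith
      then have "\<tau> * (m / 2) \<le> \<tau> * N u" using \<tau> by (intro mult_left_mono) auto
      then show ?thesis using descent[OF uM] Eu by (simp add: algebra_simps)
    next
      case False
      then have "E u \<le> c - m / 2" using Eu tm m(1) by linarith
      moreover have "E (flow (\<tau>, u)) \<le> E u - \<tau> * N u + \<tau> * m / 4"
        using descent[OF uM] by (simp add: algebra_simps)
      ultimately show ?thesis using tm N0 m(1) by linarith
    qed
  qed
  ultimately have "c - \<tau> * m / 8 \<in> L"
    unfolding L_def by blast
  then show False using c_le \<open>0 < \<tau> * m / 8\<close> by fastforce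
qed

section \<open>Balancing two infima by a parameter\<close>

text \<open>
  An infimum of affine functions of \<open>l\<close> is concave, and a finite concave function on an open interval
  is continuous. At the end point \<open>0\<close> of the closed half line
  continuity can fail.
\<close>

lemma continuous_on_INF_affine:
  fixes \<phi> \<psi> :: "'a \<Rightarrow> real"
  assumes ne: "X \<noteq> {}" and bdd: "\<And>l. l > 0 \<Longrightarrow> bdd_below ((\<lambda>x. \<phi> x + l * \<psi> x) ` X)"
  shows "continuous_on {0<..} (\<lambda>l. INF x\<in>X. \<phi> x + l * \<psi> x)"
proof -
  let ?a = "\<lambda>l. INF x\<in>X. \<phi> x + l * \<psi> x"
  have "convex_on {0<..} (\<lambda>l. - ?a l)"
  proof (rule convex_onI)
    fix t l l' :: real
    assume t: "0 < t" "t < 1" and l: "l \<in> {0<..}" "l' \<in> {0<..}"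
    have "(1 - t) * ?a l + t * ?a l' \<le> ?a ((1 - t) *\<^sub>R l + t *\<^sub>R l')"
    proof (rule cINF_greatest[OF ne])
      fix x assume x: "x \<in> X"
      have "(1 - t) * ?a l \<le> (1 - t) * (\<phi> x + l * \<psi> x)"
        using t l x by (intro mult_left_mono cINF_lower bdd) auto
      moreover have "t * ?a l' \<le> t * (\<phi> x + l' * \<psi> x)"
        using t l x by (intro mult_left_mono cINF_lower bdd) auto
      ultimately show "(1 - t) * ?a l + t * ?a l' \<le> \<phi> x + ((1 - t) *\<^sub>R l + t *\<^sub>R l') * \<psi> x"
        by (simp add: algebra_simps)
    qed
    then show "- ?a ((1 - t) *\<^sub>R l + t *\<^sub>R l') \<le> (1 - t) * - ?a l + t * - ?a l'"
      by simp
  qed simp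
  then have "continuous_on {0<..} (\<lambda>l. - ?a l)" by (rule convex_on_continuous[rotated]) simp
  from continuous_on_minus[OF this] show ?thesis by simp
qed

text \<open>
  Both infima are continuous in \<open>l\<close>, so it is enough that each order occurs somewhere. Small \<open>l\<close>: the
  lower bound of \<open>\<phi> + \<psi>\<close> on \<open>Y\<close>, taken with weight \<open>l\<close>, is outweighed by \<open>(1 - l) \<phi> \<ge> (1 - l) s\<close>. Large
  \<open>l\<close>: the point \<open>y0\<close> beats \<open>X\<close> in the \<open>\<psi>\<close> part.
\<close>

lemma infima_cross:
  fixes \<phi> \<psi> :: "'a \<Rightarrow> real"
  assumes bdd: "\<And>l. l > 0 \<Longrightarrow> bdd_below ((\<lambda>x. \<phi> x + l * \<psi> x) ` (X \<union> Y))"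
    and x0: "x0 \<in> X" "\<phi> x0 = 0" "\<psi> x0 = 0"
    and X: "\<And>x. x \<in> X \<Longrightarrow> 0 \<le> \<phi> x"
    and Y: "\<And>y. y \<in> Y \<Longrightarrow> s \<le> \<phi> y" and s: "0 < s"
    and y0: "y0 \<in> Y" "\<psi> y0 < m" and m: "\<And>x. x \<in> X \<Longrightarrow> m \<le> \<psi> x"
  shows "\<exists>l>0. (INF x\<in>X. \<phi> x + l * \<psi> x) = (INF y\<in>Y. \<phi> y + l * \<psi> y)"
proof -
  let ?a = "\<lambda>l. INF x\<in>X. \<phi> x + l * \<psi> x" and ?b = "\<lambda>l. INF y\<in>Y. \<phi> y + l * \<psi> y"
  have ne: "X \<noteq> {}" "Y \<noteq> {}" using x0 y0 by auto
  have bddX: "bdd_below ((\<lambda>x. \<phi> x + l * \<psi> x) ` X)"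
    and bddY: "bdd_below ((\<lambda>x. \<phi> x + l * \<psi> x) ` Y)" if "l > 0" for l
    using bdd[OF that] by (auto simp: image_Un)
  obtain C where C: "\<And>y. y \<in> Y \<Longrightarrow> - C \<le> \<phi> y + \<psi> y" "C > 0"
  proof -
    obtain D where D: "\<And>y. y \<in> Y \<Longrightarrow> D \<le> \<phi> y + 1 * \<psi> y"
      using bddY[of 1] unfolding bdd_below_def by auto
    show thesis by (rule that[of "\<bar>D\<bar> + 1"]) (use D in force)+
  qed
  \<comment> \<open>The value at which \<open>(1 - l) s - l C\<close>, a lower bound on \<open>Y\<close>, equals \<open>s / 2\<close>.\<close>
  define l0 where "l0 = s / (2 * (s + C))"
  have l0: "0 < l0" "l0 < 1" using s C(2) by (auto simp: l0_def)
  have "?a l0 \<le> \<phi> x0 + l0 * \<psi> x0" by (rule cINF_lower[OF bddX[OF l0(1)] x0(1)])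
  then have "?a l0 \<le> 0" using x0 by simp
  moreover have "0 \<le> ?b l0"
  proof (rule cINF_greatest[OF ne(2)])
    fix y assume y: "y \<in> Y"
    have "(1 - l0) * s \<le> (1 - l0) * \<phi> y" using Y[OF y] l0 by (intro mult_left_mono) auto
    moreover have "l0 * - C \<le> l0 * (\<phi> y + \<psi> y)" using C(1)[OF y] l0 by (intro mult_left_mono) auto
    moreover have "l0 * (s + C) = s / 2"
    proof -
      have "s + C \<noteq> 0" using s C(2) by simp
      then show ?thesis unfolding l0_def by (simp add: divide_simps)
    qed
    ultimately show "0 \<le> \<phi> y + l0 * \<psi> y" using s by (simp add: algebra_simps)
  qed
  ultimately have start: "?a l0 \<le> ?b l0" by linarith
  define l1 where "l1 = max 1 (\<phi> y0 / (m - \<psi> y0))"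
  have l1: "0 < l1" "l0 \<le> l1" using l0 by (auto simp: l1_def)
  have "?b l1 \<le> \<phi> y0 + l1 * \<psi> y0" by (rule cINF_lower[OF bddY[OF l1(1)] y0(1)])
  also have "\<dots> \<le> l1 * m"
  proof -
    have "\<phi> y0 / (m - \<psi> y0) \<le> l1" by (simp add: l1_def)
    then show ?thesis using y0 by (simp add: field_simps)
  qed
  also have "\<dots> \<le> ?a l1"
  proof (rule cINF_greatest[OF ne(1)])
    fix x assume x: "x \<in> X"
    show "l1 * m \<le> \<phi> x + l1 * \<psi> x"
      using X[OF x] mult_left_mono[OF m[OF x], of l1] l1 by linarith
  qed
  finally have stop: "?b l1 \<le> ?a l1" .
  have "continuous_on {0<..} (\<lambda>l. ?b l - ?a l)"
    by (intro continuous_intros continuous_on_INF_affine ne bddX bddY)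
  then have "continuous_on {l0..l1} (\<lambda>l. ?b l - ?a l)"
    by (rule continuous_on_subset) (use l0 in auto)
  then obtain l where "l0 \<le> l" "l \<le> l1" "?b l - ?a l = 0"
    using IVT2'[of "\<lambda>l. ?b l - ?a l" l1 0 l0] start stop l1 by auto
  then show ?thesis using l0 by (intro exI[of _ l]) auto
qed

section \<open>Powers, primitives and difference quotients\<close>

text \<open>
  The hypothesis \<open>q > 1\<close> is what makes the difference quotient \<open>\<plusminus>\<bar>h\<bar>\<^sup>q\<^sup>-\<^sup>1 / q\<close> at the origin vanish in
  the limit.
\<close>

lemma abs_powr_has_derivative:
  fixes q x :: real
  assumes q: "q > 1"
  shows "((\<lambda>x. \<bar>x\<bar> powr q / q) has_real_derivative sgn x * \<bar>x\<bar> powr (q - 1)) (at x)"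
proof (cases x "0::real" rule: linorder_cases)
  case equal
  have "((\<lambda>h::real. \<bar>h\<bar> powr (q - 1) / q) \<longlongrightarrow> \<bar>0\<bar> powr (q - 1) / q) (at 0)"
    using q by (intro tendsto_intros tendsto_powr') auto
  then have *: "((\<lambda>h::real. \<bar>h\<bar> powr (q - 1) / q) \<longlongrightarrow> 0) (at 0)" by simp
  have "((\<lambda>h::real. (\<bar>h\<bar> powr q / q) / h) \<longlongrightarrow> 0) (at 0)"
  proof (rule Lim_null_comparison[OF _ *], rule always_eventually, rule allI)
    fix h :: real
    show "norm ((\<bar>h\<bar> powr q / q) / h) \<le> \<bar>h\<bar> powr (q - 1) / q"
      using q by (cases "h = 0") (simp_all add: powr_diff abs_mult field_simps)
  qed
  then show ?thesis using equal by (simp add: DERIV_def)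
next
  case greater
  have "((\<lambda>x. x powr q / q) has_real_derivative x powr (q - 1)) (at x)"
    using q greater by (auto intro!: derivative_eq_intros)
  then have "((\<lambda>x. \<bar>x\<bar> powr q / q) has_real_derivative x powr (q - 1)) (at x)"
    by (rule has_field_derivative_transform_within_open[where S = "{0<..}"]) (use greater in auto)
  then show ?thesis using greater by simp
next
  case less
  have "((\<lambda>x. (- x) powr q / q) has_real_derivative - ((- x) powr (q - 1))) (at x)"
    using q less by (auto intro!: derivative_eq_intros)
  then have "((\<lambda>x. \<bar>x\<bar> powr q / q) has_real_derivative - ((- x) powr (q - 1))) (at x)"
    by (rule has_field_derivative_transform_within_open[where S = "{..<0}"]) (use less in auto)
  then show ?thesis using less by simp
qed

lemma continuous_signed_powr:
  fixes q :: real
  assumes "q > 0"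
  shows "continuous_on UNIV (\<lambda>x. sgn x * \<bar>x\<bar> powr q)"
proof -
  \<comment> \<open>The factor \<open>sgn x\<close> jumps at \<open>0\<close>; splitting into positive and negative part removes it.\<close>
  have "sgn x * \<bar>x\<bar> powr q = max 0 x powr q - max 0 (- x) powr q" for x :: real
    by (cases x "0::real" rule: linorder_cases) auto
  moreover have "continuous_on UNIV (\<lambda>x::real. max 0 x powr q - max 0 (- x) powr q)"
    using assms by (intro continuous_intros continuous_on_powr') auto
  ultimately show ?thesis by simp
qed

lemma primitive_has_derivative:
  assumes "continuous_on UNIV (f k)"
  shows "(primitive f k has_real_derivative f k t) (at t)"
proof -
  let ?b = "\<bar>t\<bar> + 1"
  have "((\<lambda>u. LBINT y=ereal 0..ereal u. f k y) has_vector_derivative f k t) (at t within {-?b..?b})"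
    by (rule interval_integral_FTC2) (auto intro: continuous_on_subset[OF assms])
  moreover have "at t within {-?b..?b} = at t"
    by (rule at_within_interior) auto
  ultimately show ?thesis
    by (simp add: has_real_derivative_iff_has_vector_derivative primitive_def[abs_def])
qed

lemma primitive_0 [simp]: "primitive f k 0 = 0"
  by (simp add: primitive_def)

lemma increment_le_of_derivative:
  fixes g :: "real \<Rightarrow> real"
  assumes "(g has_real_derivative D) (at x)" "e > 0"
  shows "\<exists>d>0. \<forall>h. \<bar>h\<bar> < d \<longrightarrow> \<bar>g (x + h) - g x - D * h\<bar> \<le> e * \<bar>h\<bar>"
proof -
  obtain d where d: "d > 0" "\<And>y. \<bar>y - x\<bar> < d \<Longrightarrow> \<bar>g y - g x - D * (y - x)\<bar> \<le> e * \<bar>y - x\<bar>"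
    using assms unfolding has_field_derivative_def has_derivative_at_alt by force
  show ?thesis using d(1) d(2)[of "x + h" for h] by (intro exI[of _ d]) auto
qed

lemma finite_uniform_delta:
  fixes P :: "'i \<Rightarrow> real \<Rightarrow> bool"
  assumes "finite I" "\<And>i. i \<in> I \<Longrightarrow> \<exists>d>0. \<forall>h. \<bar>h\<bar> < d \<longrightarrow> P i h"
  shows "\<exists>d>0. \<forall>i\<in>I. \<forall>h. \<bar>h\<bar> < d \<longrightarrow> P i h"
  using assms
proof (induction rule: finite_induct)
  case empty
  then show ?case by (intro exI[of _ 1]) simp
next
  case (insert i I)
  obtain d where d: "d > 0" "\<forall>h. \<bar>h\<bar> < d \<longrightarrow> P i h" using insert.prems[of i] by auto
  obtain d' where d': "d' > 0" "\<forall>i\<in>I. \<forall>h. \<bar>h\<bar> < d' \<longrightarrow> P i h"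
    using insert.IH insert.prems by auto
  show ?case using d d' by (intro exI[of _ "min d d'"]) auto
qed

lemma summation_by_parts:
  fixes a v :: "nat \<Rightarrow> real"
  shows "(\<Sum>j\<le>n. a j * (v (Suc j) - v j)) =
     (\<Sum>k=1..n. (a (k - 1) - a k) * v k) + a n * v (Suc n) - a 0 * v 0"
  by (induction n) (auto simp: algebra_simps)

text \<open>
  Membership in \<^term>\<open>H T\<close> is a support condition, which is the form in which the mountain pass
  lemma applies.
\<close>

lemma H_eq: "H T = {u. \<forall>k. k \<notin> {1..T} \<longrightarrow> u k = 0}"
proof (intro set_eqI iffI)
  fix u :: "nat \<Rightarrow> real" assume u: "u \<in> {u. \<forall>k. k \<notin> {1..T} \<longrightarrow> u k = 0}"
  then show "u \<in> H T" by (auto simp: H_def)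
next
  fix u assume u: "u \<in> H T"
  have "u k = 0" if "k \<notin> {1..T}" for k
  proof -
    have "k = 0 \<or> k = T + 1 \<or> k \<notin> {0..T + 1}" using that by auto
    then show ?thesis using u by (auto simp: H_def)
  qed
  then show "u \<in> {u. \<forall>k. k \<notin> {1..T} \<longrightarrow> u k = 0}" by blast
qed

lemma zero_in_H: "(\<lambda>_. 0) \<in> H T"
  by (simp add: H_eq)

lemma mu_eq: "mu T p u = (\<Sum>j\<le>T. \<bar>u (Suc j) - u j\<bar> powr p j / p j)"
proof -
  have "mu T p u = (\<Sum>k=Suc 0..Suc T. 1 / p (k - 1) * \<bar>fdiff u (k - 1)\<bar> powr p (k - 1))"
    by (simp add: mu_def)
  also have "\<dots> = (\<Sum>j=0..T. 1 / p j * \<bar>fdiff u j\<bar> powr p j)"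
    by (subst sum.shift_bounds_cl_Suc_ivl) simp
  finally show ?thesis by (simp add: fdiff_def atLeast0AtMost)
qed

lemma abs_diff_le_normH:
  assumes "j \<le> T"
  shows "\<bar>v (Suc j) - v j\<bar> \<le> normH T v"
proof -
  have "\<bar>fdiff v (Suc j - 1)\<bar>\<^sup>2 \<le> (\<Sum>k=1..T + 1. \<bar>fdiff v (k - 1)\<bar>\<^sup>2)"
    by (rule member_le_sum) (use assms in auto)
  then show ?thesis unfolding normH_def by (intro real_le_rsqrt) (simp add: fdiff_def)
qed

lemma abs_le_sum_abs_diff:
  assumes "v \<in> H T"
  shows "\<bar>v k\<bar> \<le> (\<Sum>j\<le>T. \<bar>v (Suc j) - v j\<bar>)"
proof (cases "k \<le> T")
  case True
  have "v k = (\<Sum>j<k. v (Suc j) - v j)"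
    using assms by (simp add: sum_lessThan_telescope H_eq)
  also have "\<bar>\<dots>\<bar> \<le> (\<Sum>j<k. \<bar>v (Suc j) - v j\<bar>)" by (rule sum_abs)
  also have "\<dots> \<le> (\<Sum>j\<le>T. \<bar>v (Suc j) - v j\<bar>)"
    by (rule sum_mono2) (use True in auto)
  finally show ?thesis .
next
  case False
  then show ?thesis using assms by (simp add: H_eq sum_nonneg)
qed

lemma abs_le_normH:
  assumes "v \<in> H T"
  shows "\<bar>v k\<bar> \<le> (real T + 1) * normH T v"
proof -
  have "\<bar>v k\<bar> \<le> (\<Sum>j\<le>T. \<bar>v (Suc j) - v j\<bar>)" by (rule abs_le_sum_abs_diff[OF assms])
  also have "\<dots> \<le> (\<Sum>j\<le>T. normH T v)" by (intro sum_mono abs_diff_le_normH) simp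
  also have "\<dots> = (real T + 1) * normH T v" by (simp add: algebra_simps)
  finally show ?thesis .
qed

lemma norm_sup_ge: "k \<le> T + 1 \<Longrightarrow> \<bar>u k\<bar> \<le> norm_sup T u"
  unfolding norm_sup_def by (rule Max_ge) auto

lemma norm_sup_attained:
  assumes u: "u \<in> H T" and T: "1 \<le> T"
  shows "\<exists>k\<in>{1..T}. \<bar>u k\<bar> = norm_sup T u"
proof -
  have "norm_sup T u \<in> (\<lambda>k. \<bar>u k\<bar>) ` {0..T + 1}"
    unfolding norm_sup_def by (rule Max_in) auto
  then obtain k where k: "\<bar>u k\<bar> = norm_sup T u" by auto
  show ?thesis
  proof (cases "k \<in> {1..T}")
    case True
    then show ?thesis using k by blast
  next
    case False
    then have "norm_sup T u = 0" using k u by (simp add: H_eq)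
    then show ?thesis using norm_sup_ge[of 1 T u] T by (intro bexI[of _ 1]) auto
  qed
qed

text \<open>
  The box is a product of compact intervals and singletons.
\<close>

lemma compact_box:
  "compact {u \<in> H T. \<forall>k. \<bar>u k\<bar> \<le> R}"
proof (cases "0 \<le> R")
  case True
  let ?X = "\<lambda>k::nat. if k \<in> {1..T} then {-R..R} else {0::real}"
  have "{u \<in> H T. \<forall>k. \<bar>u k\<bar> \<le> R} = Pi\<^sub>E UNIV ?X"
  proof (intro set_eqI iffI)
    fix u assume "u \<in> {u \<in> H T. \<forall>k. \<bar>u k\<bar> \<le> R}"
    then have "u k \<in> ?X k" for k
      unfolding H_eq by (smt (verit) atLeastAtMost_iff mem_Collect_eq singletonI)
    then show "u \<in> Pi\<^sub>E UNIV ?X" by (simp add: PiE_UNIV_domain)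
  next
    fix u assume "u \<in> Pi\<^sub>E UNIV ?X"
    then have u: "u k \<in> ?X k" for k by (rule PiE_mem) simp
    have "u k = 0" if "k \<notin> {1..T}" for k using u[of k] that by (simp only: if_False singleton_iff)
    moreover have "\<bar>u k\<bar> \<le> R" for k
      using u[of k] True by (cases "k \<in> {1..T}") (simp_all only: if_True if_False singleton_iff atLeastAtMost_iff abs_le_iff, auto)
    ultimately show "u \<in> {u \<in> H T. \<forall>k. \<bar>u k\<bar> \<le> R}" by (simp add: H_eq)
  qed
  moreover have "compactin (product_topology (\<lambda>_. euclidean) UNIV) (Pi\<^sub>E UNIV ?X)"
    by (subst compactin_PiE) (auto simp: compactin_euclidean_iff)
  ultimately show ?thesis
    by (simp add: euclidean_product_topology compactin_euclidean_iff)
next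
  case False
  then have "\<not> \<bar>u 0\<bar> \<le> R" for u :: "nat \<Rightarrow> real" by linarith
  then have "{u \<in> H T. \<forall>k. \<bar>u k\<bar> \<le> R} = {}" by blast
  then show ?thesis by (simp only: compact_empty)
qed

section \<open>The energy of the discrete Dirichlet problem\<close>

text \<open>
  The assumption \<open>growth\<close> is the form in which the asymptotic condition on the potential is used:
  it holds for all \<open>t\<close>, at the price of an additive constant.
\<close>

locale discrete_dirichlet =
  fixes T :: nat and p :: "nat \<Rightarrow> real" and f :: "nat \<Rightarrow> real \<Rightarrow> real"
  assumes T: "1 \<le> T"
    and p_min_gt: "1 < p_min T p"
    and cont_f: "\<And>k. k \<in> {1..T} \<Longrightarrow> continuous_on UNIV (f k)"
    and growth: "\<And>k \<epsilon>. k \<in> {1..T} \<Longrightarrow> 0 < \<epsilon> \<Longrightarrow>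
      \<exists>C. \<forall>t. primitive f k t \<le> \<epsilon> * \<bar>t\<bar> powr p_min T p + C"
begin

text \<open>
  The partial derivatives of the energy; the difference of the first two terms is the negative of the
  discrete \<open>p\<close>-Laplacian. It is meaningful only for \<open>1 \<le> k \<le> T\<close>: at \<open>k = 0\<close> truncated subtraction
  makes the first difference vanish.
\<close>

definition grad :: "real \<Rightarrow> (nat \<Rightarrow> real) \<Rightarrow> nat \<Rightarrow> real" where
  "grad lam u k =
     sgn (u k - u (k - 1)) * \<bar>u k - u (k - 1)\<bar> powr (p (k - 1) - 1)
     - sgn (u (Suc k) - u k) * \<bar>u (Suc k) - u k\<bar> powr (p k - 1)
     - lam * f k (u k)"

lemma p_min_le: "j \<le> T \<Longrightarrow> p_min T p \<le> p j"
  unfolding p_min_def by (rule Min_le) auto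

lemma p_gt_1: "j \<le> T \<Longrightarrow> 1 < p j"
  using p_min_le[of j] p_min_gt by linarith

lemma primitive_deriv: "k \<in> {1..T} \<Longrightarrow> (primitive f k has_real_derivative f k t) (at t)"
  using primitive_has_derivative cont_f by blast

lemma continuous_primitive: "k \<in> {1..T} \<Longrightarrow> continuous_on UNIV (primitive f k)"
  using primitive_deriv by (meson DERIV_continuous_on DERIV_subset subset_UNIV)

lemma energy_eq:
  "energy T p f lam u = (\<Sum>j\<le>T. \<bar>u (Suc j) - u j\<bar> powr p j / p j)
     - lam * (\<Sum>k=1..T. primitive f k (u k))"
  by (simp add: energy_def mu_eq J_def)

lemma energy_zero [simp]: "energy T p f lam (\<lambda>_. 0) = 0"
  by (simp add: energy_eq)

lemma mu_zero [simp]: "mu T p (\<lambda>_. 0) = 0"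
  by (simp add: mu_eq)

lemma mu_nonneg: "0 \<le> mu T p u"
  unfolding mu_eq using p_gt_1 by (intro sum_nonneg divide_nonneg_nonneg) force+

lemma continuous_mu: "continuous_on UNIV (mu T p)"
  unfolding mu_eq[abs_def] using p_gt_1
  by (intro continuous_intros continuous_on_powr' continuous_on_product_coordinates) force+

lemma continuous_J: "continuous_on UNIV (J T f)"
  unfolding J_def[abs_def]
  by (intro continuous_intros continuous_on_compose2[OF continuous_primitive]
      continuous_on_product_coordinates) auto

lemma continuous_energy: "continuous_on UNIV (energy T p f lam)"
  unfolding energy_def[abs_def] by (intro continuous_intros continuous_mu continuous_J)

lemma continuous_grad:
  assumes k: "k \<in> {1..T}"
  shows "continuous_on UNIV (\<lambda>u. grad lam u k)"
proof -
  have 1: "continuous_on UNIV (\<lambda>u::nat\<Rightarrow>real. sgn (u i - u j) * \<bar>u i - u j\<bar> powr (p l - 1))"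
    if "l \<le> T" for i j l
    by (rule continuous_on_compose2[OF continuous_signed_powr])
      (use p_gt_1[OF that] in \<open>auto intro!: continuous_intros continuous_on_product_coordinates\<close>)
  have 2: "continuous_on UNIV (\<lambda>u. f k (u k))"
    by (rule continuous_on_compose2[OF cont_f[OF k] continuous_on_product_coordinates]) simp
  show ?thesis unfolding grad_def
    using k by (intro continuous_intros 1 2) auto
qed

text \<open>
  Summation by parts: the boundary terms vanish since \<open>v\<close> does so at \<open>0\<close> and \<open>T + 1\<close>.
\<close>

lemma sum_grad:
  assumes v: "v \<in> H T"
  shows "(\<Sum>k=1..T. grad lam u k * v k) =
    (\<Sum>j\<le>T. (sgn (u (Suc j) - u j) * \<bar>u (Suc j) - u j\<bar> powr (p j - 1)) * (v (Suc j) - v j))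
      - lam * (\<Sum>k=1..T. f k (u k) * v k)"
proof -
  let ?a = "\<lambda>j. sgn (u (Suc j) - u j) * \<bar>u (Suc j) - u j\<bar> powr (p j - 1)"
  have "(\<Sum>j\<le>T. ?a j * (v (Suc j) - v j)) =
      (\<Sum>k=1..T. (?a (k - 1) - ?a k) * v k) + ?a T * v (Suc T) - ?a 0 * v 0"
    by (rule summation_by_parts)
  moreover have "v 0 = 0" "v (Suc T) = 0" using v by (auto simp: H_eq)
  moreover have "(\<Sum>k=1..T. grad lam u k * v k) =
      (\<Sum>k=1..T. (?a (k - 1) - ?a k) * v k - lam * (f k (u k) * v k))"
    by (intro sum.cong) (auto simp: grad_def algebra_simps)
  ultimately show ?thesis
    by (simp only: sum_subtractf sum_distrib_left mult_zero_right add_0_right diff_0_right)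
qed

lemma energy_directional_derivative:
  assumes v: "v \<in> H T"
  shows "((\<lambda>t. energy T p f lam (\<lambda>k. u k + t * v k)) has_real_derivative
           (\<Sum>k=1..T. grad lam u k * v k)) (at 0)"
proof -
  have 1: "((\<lambda>t. \<bar>(u (Suc j) + t * v (Suc j)) - (u j + t * v j)\<bar> powr p j / p j) has_real_derivative
      (sgn (u (Suc j) - u j) * \<bar>u (Suc j) - u j\<bar> powr (p j - 1)) * (v (Suc j) - v j)) (at 0)"
    if "j \<in> {..T}" for j
  proof (rule DERIV_chain2[where f = "\<lambda>x. \<bar>x\<bar> powr p j / p j"])
    show "((\<lambda>t. u (Suc j) + t * v (Suc j) - (u j + t * v j)) has_real_derivative v (Suc j) - v j) (at 0)"
      by (auto intro!: derivative_eq_intros)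
    show "((\<lambda>x. \<bar>x\<bar> powr p j / p j) has_real_derivative
      sgn (u (Suc j) - u j) * \<bar>u (Suc j) - u j\<bar> powr (p j - 1))
        (at (u (Suc j) + 0 * v (Suc j) - (u j + 0 * v j)))"
      using abs_powr_has_derivative[OF p_gt_1, of j "u (Suc j) - u j"] that by simp
  qed
  have 2: "((\<lambda>t. primitive f k (u k + t * v k)) has_real_derivative f k (u k) * v k) (at 0)"
    if "k \<in> {1..T}" for k
  proof (rule DERIV_chain2[where f = "primitive f k"])
    show "((\<lambda>t. u k + t * v k) has_real_derivative v k) (at 0)"
      by (auto intro!: derivative_eq_intros)
    show "(primitive f k has_real_derivative f k (u k)) (at (u k + 0 * v k))"
      using primitive_deriv[OF that] by simp
  qed
  show ?thesis
    unfolding energy_eq sum_grad[OF v]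
    by (intro DERIV_diff DERIV_sum DERIV_cmult 1 2)
qed

text \<open>
  The energy is a finite sum of functions of one variable, evaluated at the differences and at the
  values of \<open>u\<close>. Each has a first order expansion whose remainder is \<open>o\<close> of the increment of its
  argument, and these increments are at most \<open>(T + 1) \<parallel>v\<parallel>\<close>. The linear parts add up to the pairing of
  \<open>v\<close> with the gradient, so the zero functional is the derivative when the gradient vanishes.
\<close>

lemma critical_point_of_grad:
  assumes u: "u \<in> H T" and g: "\<And>k. k \<in> {1..T} \<Longrightarrow> grad lam u k = 0"
  shows "critical_point T (energy T p f lam) u"
proof -
  define A where "A j = sgn (u (Suc j) - u j) * \<bar>u (Suc j) - u j\<bar> powr (p j - 1)" for j
  have small: "\<exists>d>0. \<forall>v\<in>H T. normH T v < d \<longrightarrow>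
        \<bar>energy T p f lam (\<lambda>k. u k + v k) - energy T p f lam u - 0\<bar> \<le> e * normH T v"
    if e: "e > 0" for e
  proof -
    let ?n = "real T + 1"
    define K where "K = ?n + \<bar>lam\<bar> * (T * ?n)"
    have K: "K > 0" unfolding K_def by (intro add_pos_nonneg[of ?n]) auto
    define e' where "e' = e / K"
    have e': "e' > 0" using e K by (simp add: e'_def)
    define R where "R j h = (let x = u (Suc j) - u j in
      \<bar>x + h\<bar> powr p j / p j - \<bar>x\<bar> powr p j / p j - A j * h)" for j h
    define S where "S k h = primitive f k (u k + h) - primitive f k (u k) - f k (u k) * h" for k h
    have "\<exists>d>0. \<forall>j\<in>{..T}. \<forall>h. \<bar>h\<bar> < d \<longrightarrow> \<bar>R j h\<bar> \<le> e' * \<bar>h\<bar>"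
      unfolding R_def Let_def A_def
      by (intro finite_uniform_delta increment_le_of_derivative abs_powr_has_derivative e')
        (auto intro: p_gt_1)
    then obtain d1 where d1: "d1 > 0" "\<And>j h. j \<le> T \<Longrightarrow> \<bar>h\<bar> < d1 \<Longrightarrow> \<bar>R j h\<bar> \<le> e' * \<bar>h\<bar>" by auto
    have "\<exists>d>0. \<forall>k\<in>{1..T}. \<forall>h. \<bar>h\<bar> < d \<longrightarrow> \<bar>S k h\<bar> \<le> e' * \<bar>h\<bar>"
      unfolding S_def
      by (intro finite_uniform_delta increment_le_of_derivative primitive_deriv e') auto
    then obtain d2 where d2: "d2 > 0" "\<And>k h. k \<in> {1..T} \<Longrightarrow> \<bar>h\<bar> < d2 \<Longrightarrow> \<bar>S k h\<bar> \<le> e' * \<bar>h\<bar>" by auto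
    have main: "\<bar>energy T p f lam (\<lambda>k. u k + v k) - energy T p f lam u - 0\<bar> \<le> e * normH T v"
      if v: "v \<in> H T" and n: "normH T v < min d1 (d2 / ?n)" for v
    proof -
      have n1: "normH T v < d1" and n2: "?n * normH T v < d2"
        using n by (auto simp: field_simps)
      have R: "\<bar>R j (v (Suc j) - v j)\<bar> \<le> e' * normH T v" if "j \<in> {..T}" for j
      proof -
        have le: "\<bar>v (Suc j) - v j\<bar> \<le> normH T v" using abs_diff_le_normH that by auto
        then have "\<bar>R j (v (Suc j) - v j)\<bar> \<le> e' * \<bar>v (Suc j) - v j\<bar>"
          using d1(2) n1 that by auto
        also have "\<dots> \<le> e' * normH T v" using le e' by (intro mult_left_mono) auto
        finally show ?thesis .
      qed
      have S: "\<bar>S k (v k)\<bar> \<le> e' * (?n * normH T v)" if "k \<in> {1..T}" for k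
      proof -
        have le: "\<bar>v k\<bar> \<le> ?n * normH T v" by (rule abs_le_normH[OF v])
        then have "\<bar>S k (v k)\<bar> \<le> e' * \<bar>v k\<bar>" using n2 by (intro d2(2)[OF that]) linarith
        also have "\<dots> \<le> e' * (?n * normH T v)" using le e' by (intro mult_left_mono) auto
        finally show ?thesis .
      qed
      have zero: "(\<Sum>j\<le>T. A j * (v (Suc j) - v j)) - lam * (\<Sum>k=1..T. f k (u k) * v k) = 0"
        using sum_grad[OF v, of lam u] g by (simp add: A_def)
      have "energy T p f lam (\<lambda>k. u k + v k) - energy T p f lam u
         = (\<Sum>j\<le>T. R j (v (Suc j) - v j)) - lam * (\<Sum>k=1..T. S k (v k))"
      proof -
        have Rs: "(\<Sum>j\<le>T. R j (v (Suc j) - v j)) =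
          (\<Sum>j\<le>T. \<bar>u (Suc j) + v (Suc j) - (u j + v j)\<bar> powr p j / p j)
          - (\<Sum>j\<le>T. \<bar>u (Suc j) - u j\<bar> powr p j / p j) - (\<Sum>j\<le>T. A j * (v (Suc j) - v j))"
          unfolding R_def Let_def sum_subtractf[symmetric]
          by (intro sum.cong) (auto simp: algebra_simps)
        have Ss: "(\<Sum>k=1..T. S k (v k)) = (\<Sum>k=1..T. primitive f k (u k + v k))
          - (\<Sum>k=1..T. primitive f k (u k)) - (\<Sum>k=1..T. f k (u k) * v k)"
          by (simp add: S_def sum_subtractf)
        have "lam * (\<Sum>k=1..T. S k (v k)) = lam * (\<Sum>k=1..T. primitive f k (u k + v k))
          - lam * (\<Sum>k=1..T. primitive f k (u k)) - lam * (\<Sum>k=1..T. f k (u k) * v k)"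
          by (simp only: Ss right_diff_distrib)
        then show ?thesis
          unfolding energy_eq Rs using zero by linarith
      qed
      also have "\<bar>\<dots>\<bar> \<le> \<bar>\<Sum>j\<le>T. R j (v (Suc j) - v j)\<bar> + \<bar>lam\<bar> * \<bar>\<Sum>k=1..T. S k (v k)\<bar>"
        by (simp add: abs_triangle_ineq4 abs_mult[symmetric])
      also have "\<dots> \<le> (\<Sum>j\<le>T. e' * normH T v) + \<bar>lam\<bar> * (\<Sum>k=1..T. e' * (?n * normH T v))"
        using R S by (intro add_mono mult_left_mono order_trans[OF sum_abs] sum_mono) auto
      also have "\<dots> = e' * K * normH T v" by (simp add: K_def algebra_simps)
      also have "\<dots> = e * normH T v" using K by (simp add: e'_def)
      finally show ?thesis by simp
    qed
    show ?thesis
      using d1(1) d2(1) main by (intro exI[of _ "min d1 (d2 / ?n)"]) auto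
  qed
  have "has_derivative_H T (energy T p f lam) (\<lambda>_. 0) u"
    unfolding has_derivative_H_def using small by (auto intro: exI[of _ 0])
  then show ?thesis unfolding critical_point_def using u by blast
qed

lemma grad_zero_of_minimum:
  assumes u: "u \<in> H T" and min: "\<And>w. w \<in> H T \<Longrightarrow> energy T p f lam u \<le> energy T p f lam w"
  shows "\<forall>k\<in>{1..T}. grad lam u k = 0"
proof -
  define v where "v k = (if k \<in> {1..T} then grad lam u k else 0)" for k
  have v: "v \<in> H T" by (auto simp: v_def H_eq)
  have "(\<Sum>k=1..T. grad lam u k * v k) = 0"
  proof (rule DERIV_local_min[OF energy_directional_derivative[OF v], of 1])
    show "\<forall>y. \<bar>0 - y\<bar> < 1 \<longrightarrow>
        energy T p f lam (\<lambda>k. u k + 0 * v k) \<le> energy T p f lam (\<lambda>k. u k + y * v k)"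
      using u v by (auto intro!: min simp: H_eq)
  qed simp
  then have "(\<Sum>k=1..T. (grad lam u k)\<^sup>2) = 0"
    by (simp add: v_def power2_eq_square)
  then show ?thesis by (simp add: sum_nonneg_eq_0_iff)
qed

text \<open>
  If \<open>u\<close> is as large as \<open>M \<ge> T + 1\<close> somewhere, then one of its \<open>T + 1\<close> differences is at least
  \<open>M / (T + 1) \<ge> 1\<close>, so \<open>\<mu> u\<close> is at least a constant times \<open>M\<^sup>q\<close> with \<open>q = p\<^sup>-\<close>. The potential is at most
  \<open>\<epsilon> T M\<^sup>q\<close> up to a constant, and with \<open>\<epsilon>\<close> small compared to \<open>1 / \<lambda>\<close> it absorbs at most half of that.
  The case \<open>\<lambda> = 0\<close> says that the sublevel sets of \<open>\<mu>\<close> are bounded.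
\<close>

lemma coercive:
  assumes lam: "0 \<le> lam"
  shows "\<exists>R. \<forall>u\<in>H T. energy T p f lam u \<le> a \<longrightarrow> (\<forall>k. \<bar>u k\<bar> \<le> R)"
proof -
  let ?q = "p_min T p" and ?n = "real T + 1"
  define P where "P = Max (p ` {..T})"
  have pP: "p j \<le> P" if "j \<le> T" for j unfolding P_def using that by (intro Max_ge) auto
  have P: "P > 0" using pP[of 0] p_gt_1[of 0] by simp
  define c where "c = 1 / (P * ?n powr ?q)"
  have c: "c > 0" using P by (simp add: c_def)
  have mu_ge: "c * \<bar>u k\<bar> powr ?q \<le> mu T p u" if u: "u \<in> H T" and k: "?n \<le> \<bar>u k\<bar>" for u k
  proof -
    let ?x = "\<bar>u k\<bar> / ?n"
    have x: "1 \<le> ?x" using k by simp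
    obtain j where j: "j \<le> T" "?x \<le> \<bar>u (Suc j) - u j\<bar>"
    proof (rule ccontr)
      assume "\<not> thesis"
      then have lt: "\<bar>u (Suc j) - u j\<bar> < ?x" if "j \<le> T" for j using \<open>\<And>j. j \<le> T \<Longrightarrow> _ \<Longrightarrow> thesis\<close> that by force
      have "\<bar>u k\<bar> \<le> (\<Sum>j\<le>T. \<bar>u (Suc j) - u j\<bar>)" by (rule abs_le_sum_abs_diff[OF u])
      also have "\<dots> < (\<Sum>j\<le>T. ?x)" by (rule sum_strict_mono) (use lt in auto)
      also have "\<dots> = \<bar>u k\<bar>" by (simp add: field_simps)
      finally show False by simp
    qed
    have "c * \<bar>u k\<bar> powr ?q = ?x powr ?q / P"
      using P by (simp add: c_def powr_divide)
    also have "\<dots> \<le> ?x powr p j / P"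
      using x p_min_le[OF j(1)] P by (intro divide_right_mono powr_mono) auto
    also have "\<dots> \<le> \<bar>u (Suc j) - u j\<bar> powr p j / P"
      using j x p_gt_1[OF j(1)] P by (intro divide_right_mono powr_mono2) auto
    also have "\<dots> \<le> \<bar>u (Suc j) - u j\<bar> powr p j / p j"
      using pP[OF j(1)] p_gt_1[OF j(1)] by (intro divide_left_mono) auto
    also have "\<dots> \<le> mu T p u"
      unfolding mu_eq using j p_gt_1 by (intro member_le_sum divide_nonneg_nonneg) force+
    finally show ?thesis .
  qed
  define \<epsilon> where "\<epsilon> = c / (2 * (lam + 1) * T)"
  have \<epsilon>: "\<epsilon> > 0" using c lam T by (simp add: \<epsilon>_def)
  have \<epsilon>_le: "lam * (T * \<epsilon>) \<le> c / 2"
  proof -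
    have "T * \<epsilon> = c / (2 * (lam + 1))" using T lam by (simp add: \<epsilon>_def)
    then have "lam * (T * \<epsilon>) = c / 2 * (lam / (lam + 1))" by simp
    also have "\<dots> \<le> c / 2 * 1" using c lam by (intro mult_left_mono) auto
    finally show ?thesis by simp
  qed
  obtain C where C: "\<And>k t. k \<in> {1..T} \<Longrightarrow> primitive f k t \<le> \<epsilon> * \<bar>t\<bar> powr ?q + C k"
    using growth[OF _ \<epsilon>] by metis
  define B where "B = lam * (\<Sum>k=1..T. C k)"
  define R where "R = max ?n (2 * (a + B) / c)"
  have "\<bar>u k\<bar> \<le> R" if u: "u \<in> H T" and le: "energy T p f lam u \<le> a" for u k
  proof -
    obtain i where i: "i \<in> {1..T}" "\<bar>u i\<bar> = norm_sup T u" using norm_sup_attained[OF u T] by blast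
    have ui: "\<bar>u h\<bar> \<le> \<bar>u i\<bar>" for h
      using i norm_sup_ge[of h T u] u by (cases "h \<le> T + 1") (auto simp: H_eq)
    have "\<bar>u i\<bar> \<le> R"
    proof (cases "?n \<le> \<bar>u i\<bar>")
      case False
      then show ?thesis by (simp add: R_def)
    next
      case True
      let ?M = "\<bar>u i\<bar> powr ?q"
      have "(\<Sum>k=1..T. primitive f k (u k)) \<le> (\<Sum>k=1..T. \<epsilon> * ?M + C k)"
      proof (rule sum_mono)
        fix h assume h: "h \<in> {1..T}"
        have "\<epsilon> * \<bar>u h\<bar> powr ?q \<le> \<epsilon> * ?M"
          using ui[of h] \<epsilon> p_min_gt by (intro mult_left_mono powr_mono2) auto
        then show "primitive f h (u h) \<le> \<epsilon> * ?M + C h" using C[OF h, of "u h"] by linarith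
      qed
      also have "\<dots> = T * \<epsilon> * ?M + (\<Sum>k=1..T. C k)" by (simp add: sum.distrib)
      finally have "lam * (\<Sum>k=1..T. primitive f k (u k)) \<le> lam * (T * \<epsilon> * ?M + (\<Sum>k=1..T. C k))"
        using lam by (rule mult_left_mono)
      also have "\<dots> = lam * (T * \<epsilon>) * ?M + B" by (simp add: B_def algebra_simps)
      also have "\<dots> \<le> c / 2 * ?M + B"
        using \<epsilon>_le by (intro add_right_mono mult_right_mono) auto
      finally have "c * ?M - (c / 2 * ?M + B) \<le> a"
        using mu_ge[OF u True] le by (simp add: energy_def J_def)
      moreover have "\<bar>u i\<bar> powr 1 \<le> ?M" using True p_min_gt by (intro powr_mono) auto
      then have "c / 2 * \<bar>u i\<bar> \<le> c / 2 * ?M" using c True by (intro mult_left_mono) auto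
      ultimately have "c / 2 * \<bar>u i\<bar> \<le> a + B" by linarith
      then have "\<bar>u i\<bar> \<le> 2 * (a + B) / c" using c by (simp add: field_simps)
      then show ?thesis by (simp add: R_def)
    qed
    then show ?thesis using ui[of k] by linarith
  qed
  then show ?thesis by blast
qed

lemma compact_sublevel:
  assumes lam: "0 \<le> lam"
  shows "compact {u \<in> H T. energy T p f lam u \<le> a}"
proof -
  obtain R where R: "\<forall>u\<in>H T. energy T p f lam u \<le> a \<longrightarrow> (\<forall>k. \<bar>u k\<bar> \<le> R)"
    using coercive[OF lam] by blast
  then have "{u \<in> H T. energy T p f lam u \<le> a}
      = {u \<in> H T. \<forall>k. \<bar>u k\<bar> \<le> R} \<inter> {u. energy T p f lam u \<le> a}"
    by blast
  moreover have "closed {u. energy T p f lam u \<le> a}"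
    by (intro closed_Collect_le continuous_energy continuous_on_const)
  ultimately show ?thesis using compact_box by (simp add: compact_Int_closed)
qed

lemma energy_attains_minimum:
  assumes lam: "0 \<le> lam" and Z: "closed Z" and z: "z \<in> H T \<inter> Z"
  shows "\<exists>u\<in>H T \<inter> Z. \<forall>w\<in>H T \<inter> Z. energy T p f lam u \<le> energy T p f lam w"
proof -
  let ?E = "energy T p f lam"
  let ?K = "{w \<in> H T. ?E w \<le> ?E z} \<inter> Z"
  have "compact ?K" by (intro compact_Int_closed compact_sublevel lam Z)
  moreover have "?K \<noteq> {}" using z by blast
  moreover have "continuous_on ?K ?E" by (rule continuous_on_subset[OF continuous_energy]) simp
  ultimately have "\<exists>u\<in>?K. \<forall>w\<in>?K. ?E u \<le> ?E w" by (rule continuous_attains_inf)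
  then obtain u where u: "u \<in> ?K" "\<forall>w\<in>?K. ?E u \<le> ?E w" by (rule bexE)
  have "?E u \<le> ?E w" if "w \<in> H T \<inter> Z" for w
    using u that by (cases "?E w \<le> ?E z") auto
  then show ?thesis using u by blast
qed

text \<open>
  The abstract form of the argument: \<open>J\<close> is nonnegative on the annulus \<open>r \<le> \<mu> \<le> s\<close>, and somewhere it
  falls below a lower bound \<open>m\<close> for its values on \<open>\<mu> \<le> s\<close>.
\<close>

lemma three_critical_points:
  assumes r: "0 < r" and rs: "r < s"
    and annulus: "\<And>u. u \<in> H T \<Longrightarrow> r \<le> mu T p u \<Longrightarrow> mu T p u \<le> s \<Longrightarrow> 0 \<le> J T f u"
    and ball: "\<And>u. u \<in> H T \<Longrightarrow> mu T p u \<le> s \<Longrightarrow> m \<le> J T f u"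
    and u0: "u0 \<in> H T" "J T f u0 < m"
  shows "\<exists>lam>0. \<exists>u1 u2 u3.
           critical_point T (energy T p f lam) u1 \<and>
           critical_point T (energy T p f lam) u2 \<and>
           critical_point T (energy T p f lam) u3 \<and>
           u1 \<noteq> u2 \<and> u1 \<noteq> u3 \<and> u2 \<noteq> u3 \<and>
           u1 \<noteq> (\<lambda>_. 0) \<and> u2 \<noteq> (\<lambda>_. 0)"
proof -
  let ?E = "energy T p f"
  define X where "X = H T \<inter> {u. mu T p u \<le> r}"
  define Y where "Y = H T \<inter> {u. s \<le> mu T p u}"
  have closed: "closed {u. mu T p u \<le> r}" "closed {u. s \<le> mu T p u}"
    by (intro closed_Collect_le continuous_mu continuous_on_const)+
  have zX: "(\<lambda>_. 0) \<in> X" using r by (simp add: X_def zero_in_H)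
  have u0Y: "u0 \<in> Y" using u0 ball[of u0] by (force simp: Y_def)
  have E: "mu T p u + lam * J T f u = ?E lam u" for lam u by (simp add: energy_def)
  have bdd: "bdd_below ((\<lambda>u. mu T p u + l * J T f u) ` (X \<union> Y))" if "0 < l" for l
  proof -
    obtain u where "\<forall>w\<in>H T. ?E l u \<le> ?E l w"
      using energy_attains_minimum[of l UNIV u0] u0 \<open>0 < l\<close> by auto
    then show ?thesis
      unfolding E by (intro bdd_belowI2[of _ "?E l u"]) (auto simp: X_def Y_def)
  qed
  have "\<exists>l>0. (INF u\<in>X. mu T p u + l * J T f u) = (INF u\<in>Y. mu T p u + l * J T f u)"
  proof (rule infima_cross[where s = s and m = m])
    show "\<And>l. 0 < l \<Longrightarrow> bdd_below ((\<lambda>u. mu T p u + l * J T f u) ` (X \<union> Y))" by (rule bdd)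
    show "(\<lambda>_. 0) \<in> X" "u0 \<in> Y" "J T f u0 < m" by fact+
    show "0 < s" using r rs by simp
  qed (use rs ball mu_nonneg in \<open>auto simp: X_def Y_def J_def\<close>)
  then obtain lam where lam: "lam > 0" and eq: "(INF u\<in>X. ?E lam u) = (INF u\<in>Y. ?E lam u)"
    unfolding E by blast
  obtain u1 where u1: "u1 \<in> X" "\<And>w. w \<in> X \<Longrightarrow> ?E lam u1 \<le> ?E lam w"
    using energy_attains_minimum[OF _ closed(1), of lam "\<lambda>_. 0"] lam zX unfolding X_def by force
  obtain u2 where u2: "u2 \<in> Y" "\<And>w. w \<in> Y \<Longrightarrow> ?E lam u2 \<le> ?E lam w"
    using energy_attains_minimum[OF _ closed(2), of lam u0] lam u0Y unfolding Y_def by force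
  have "(INF u\<in>X. ?E lam u) = ?E lam u1" using u1 by (intro cInf_eq_minimum) auto
  moreover have "(INF u\<in>Y. ?E lam u) = ?E lam u2" using u2 by (intro cInf_eq_minimum) auto
  ultimately have E12: "?E lam u1 = ?E lam u2" using eq by simp
  have E1: "?E lam u1 \<le> 0" using u1(2)[OF zX] by simp
  have annulus_ge: "r \<le> ?E lam u" if "u \<in> H T" "r \<le> mu T p u" "mu T p u \<le> s" for u
    using annulus[OF that] that lam by (simp add: energy_def add_increasing2)
  have global: "?E lam u1 \<le> ?E lam w" if w: "w \<in> H T" for w
  proof -
    consider "w \<in> X" | "w \<in> Y" | "r \<le> mu T p w" "mu T p w \<le> s"
      using w by (force simp: X_def Y_def)
    then show ?thesis
    proof cases
      case 3
      then show ?thesis using annulus_ge[OF w] E1 r by linarith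
    qed (use u1(2) u2(2) E12 in auto)
  qed
  have H12: "u1 \<in> H T" "u2 \<in> H T" using u1 u2 by (auto simp: X_def Y_def)
  have g1: "\<forall>k\<in>{1..T}. grad lam u1 k = 0" using grad_zero_of_minimum H12 global by blast
  have g2: "\<forall>k\<in>{1..T}. grad lam u2 k = 0"
    using grad_zero_of_minimum H12 global E12 by metis
  \<comment> \<open>The barrier hypothesis of the mountain pass lemma is the intermediate value theorem for \<open>\<mu>\<close> on a
    connected set: \<open>\<mu> u1 \<le> r < s \<le> \<mu> u2\<close>.\<close>
  have "\<exists>u\<in>H T. (\<forall>k\<in>{1..T}. grad lam u k = 0) \<and> r \<le> ?E lam u"
  proof (rule mountain_pass[OF _ H_eq])
    fix S assume S: "connected S" "S \<subseteq> H T" "u1 \<in> S" "u2 \<in> S"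
    have "connected (mu T p ` S)"
      using S(1) by (intro connected_continuous_image continuous_on_subset[OF continuous_mu]) auto
    then have "{mu T p u1..mu T p u2} \<subseteq> mu T p ` S"
      using S by (intro connected_contains_Icc) auto
    moreover have "r \<in> {mu T p u1..mu T p u2}" using u1(1) u2(1) rs by (auto simp: X_def Y_def)
    ultimately obtain w where "w \<in> S" "mu T p w = r" by auto
    then show "\<exists>u\<in>S. r \<le> ?E lam u" using annulus_ge[of w] S(2) rs by auto
  next
    show "((\<lambda>t. ?E lam (\<lambda>k. u k + t * v k)) has_real_derivative
        (\<Sum>k=1..T. grad lam u k * v k)) (at 0)" if "v \<in> H T" for u v
      using that by (rule energy_directional_derivative)
    show "continuous_on (H T) (\<lambda>u. grad lam u k)" if "k \<in> {1..T}" for k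
      using continuous_grad[OF that] by (rule continuous_on_subset) simp
    show "continuous_on (H T) (?E lam)"
      using continuous_energy by (rule continuous_on_subset) simp
    show "compact {u \<in> H T. ?E lam u \<le> a}" for a
      using lam by (intro compact_sublevel) simp
  qed (use H12 g1 g2 in auto)
  then obtain u3 where u3: "u3 \<in> H T" "\<forall>k\<in>{1..T}. grad lam u3 k = 0" "r \<le> ?E lam u3" by blast
  have crit: "critical_point T (?E lam) u1" "critical_point T (?E lam) u2" "critical_point T (?E lam) u3"
    using critical_point_of_grad H12 g1 g2 u3 by blast+
  have "u2 \<noteq> u3" "u1 \<noteq> u3" "u3 \<noteq> (\<lambda>_. 0)" using u3(3) E1 E12 r by auto
  moreover have "u2 \<noteq> u1" "u2 \<noteq> (\<lambda>_. 0)" using u1(1) u2(1) r rs by (auto simp: X_def Y_def)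
  ultimately show ?thesis using lam crit by metis
qed

end

section \<open>Growth and suprema of the potential\<close>

text \<open>
  The suprema are taken over independent variables, so a sum of suprema is the supremum of the sums.
  The induction peels off one summand at a time, which treats finite and infinite suprema alike.
\<close>

lemma less_sum_SUP_ereal:
  fixes F :: "'i \<Rightarrow> 'a \<Rightarrow> real"
  assumes "finite I" "ereal m < (\<Sum>k\<in>I. SUP t. ereal (F k t))"
  shows "\<exists>t. m < (\<Sum>k\<in>I. F k (t k))"
  using assms
proof (induction I arbitrary: m rule: finite_induct)
  case empty
  then show ?case by simp
next
  case (insert k I)
  let ?S = "\<lambda>k. SUP t. ereal (F k t)"
  let ?R = "\<Sum>k\<in>I. ?S k"
  have S: "?S k \<noteq> -\<infinity>" for k
  proof -
    have "ereal (F k undefined) \<le> ?S k" by (rule SUP_upper) simp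
    then show ?thesis by auto
  qed
  have R: "?R \<noteq> -\<infinity>" using insert.hyps(1)
  proof (induction rule: finite_induct)
    case (insert j J)
    then show ?case using S[of j] by simp
  qed simp
  have lt: "ereal m < ?S k + ?R" using insert.hyps insert.prems by simp
  obtain t where t: "ereal (m - F k t) < ?R"
  proof (cases ?R)
    case (real x)
    then have "ereal (m - x) < ?S k" using lt S[of k] by (cases "?S k") auto
    then obtain t where "ereal (m - x) < ereal (F k t)" unfolding less_SUP_iff by blast
    then show thesis using that[of t] real by simp
  next
    case PInf
    then show thesis using that by simp
  next
    case MInf
    then show thesis using R by simp
  qed
  from insert.IH[OF this] obtain u where u: "m - F k t < (\<Sum>j\<in>I. F j (u j))" by blast
  have "(\<Sum>j\<in>I. F j ((u(k := t)) j)) = (\<Sum>j\<in>I. F j (u j))"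
    using insert.hyps(2) by (intro sum.cong) auto
  then show ?case using u insert.hyps by (intro exI[of _ "u(k := t)"]) auto
qed

text \<open>
  Far out the limsup condition bounds \<open>F\<close>; the constant is the maximum of \<open>F\<close> on the remaining
  compact interval.
\<close>

lemma growth_bound_of_Limsup:
  fixes F :: "real \<Rightarrow> real"
  assumes lim: "Limsup at_infinity (\<lambda>t. ereal (F t / \<bar>t\<bar> powr q)) \<le> 0"
    and cont: "continuous_on UNIV F" and e: "0 < e"
  shows "\<exists>C. \<forall>t. F t \<le> e * \<bar>t\<bar> powr q + C"
proof -
  have "Limsup at_infinity (\<lambda>t. ereal (F t / \<bar>t\<bar> powr q)) < ereal e"
    using lim e by (meson ereal_less(2) le_less_trans)
  then have "\<forall>\<^sub>F t in at_infinity. ereal (F t / \<bar>t\<bar> powr q) < ereal e"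
    by (rule Limsup_lessD)
  then have "\<forall>\<^sub>F t in at_infinity. F t / \<bar>t\<bar> powr q < e" by simp
  then obtain b where b: "\<And>t. b \<le> \<bar>t\<bar> \<Longrightarrow> F t / \<bar>t\<bar> powr q < e"
    by (auto simp: eventually_at_infinity)
  let ?b = "max b 1"
  have "compact (F ` {-?b..?b})"
    by (intro compact_continuous_image continuous_on_subset[OF cont]) auto
  then have "bdd_above (F ` {-?b..?b})" by (intro bounded_imp_bdd_above compact_imp_bounded)
  then obtain C where "\<forall>y\<in>F ` {-?b..?b}. y \<le> C" unfolding bdd_above_def by blast
  then have C: "F t \<le> C" if "t \<in> {-?b..?b}" for t using that by blast
  have "F t \<le> e * \<bar>t\<bar> powr q + \<bar>C\<bar>" for t
  proof (cases "\<bar>t\<bar> \<le> ?b")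
    case True
    then have "F t \<le> C" by (intro C) auto
    moreover have "0 \<le> e * \<bar>t\<bar> powr q" using e by simp
    ultimately show ?thesis by linarith
  next
    case False
    then have "F t < e * \<bar>t\<bar> powr q" using b[of t] by (simp add: field_simps)
    then show ?thesis by linarith
  qed
  then show ?thesis by blast
qed

lemma SUP_eq_maximum:
  fixes F :: "real \<Rightarrow> real"
  assumes cont: "continuous_on UNIV F" and a: "0 \<le> a"
  shows "\<exists>M. (SUP t\<in>{t. \<bar>t\<bar> \<le> a}. ereal (F t)) = ereal M \<and> (\<forall>t. \<bar>t\<bar> \<le> a \<longrightarrow> F t \<le> M)"
proof -
  have eq: "{t. \<bar>t\<bar> \<le> a} = {-a..a}" by auto
  obtain x where x: "x \<in> {-a..a}" "\<forall>t\<in>{-a..a}. F t \<le> F x"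
    using continuous_attains_sup[of "{-a..a}" F] continuous_on_subset[OF cont] a by auto
  then have "(SUP t\<in>{-a..a}. ereal (F t)) = ereal (F x)"
    by (intro antisym SUP_least SUP_upper) auto
  moreover have "F t \<le> F x" if "\<bar>t\<bar> \<le> a" for t
    using x(2) that eq by blast
  ultimately show ?thesis unfolding eq by blast
qed

section \<open>Three critical points under the hypotheses on the potential\<close>

theorem theorem12:
  fixes T :: nat
    and p :: "nat \<Rightarrow> real"
    and f :: "nat \<Rightarrow> real \<Rightarrow> real"
    and r s :: real
  defines "r' \<equiv> inf_radius T p r"
    and "s' \<equiv> sup_radius T p s"
  assumes "T \<ge> 1"
    and "\<forall>k\<in>{0..T + 1}. p k > 0"
    and "p_min T p > 1"
    and "\<forall>k\<in>{1..T}. continuous_on UNIV (f k)"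
    and "0 < r" and "r < s"
    and "\<forall>k\<in>{1..T}.
           Limsup at_infinity (\<lambda>t. ereal (primitive f k t / \<bar>t\<bar> powr p_min T p)) \<le> 0"
    and "(\<Sum>k=1..T. SUP t\<in>{t. \<bar>t\<bar> \<le> s'}. ereal (primitive f k t))
           < (\<Sum>k=1..T. SUP t\<in>UNIV. ereal (primitive f k t))"
    and "\<forall>k\<in>{1..T}. (SUP t\<in>{t. r' \<le> \<bar>t\<bar> \<and> \<bar>t\<bar> \<le> s'}. ereal (primitive f k t))
           \<le> - (\<Sum>h\<in>{1..T} - {k}. SUP t\<in>{t. \<bar>t\<bar> \<le> s'}. ereal (primitive f h t))"
  shows "\<exists>lam>0. \<exists>u1 u2 u3.
           critical_point T (energy T p f lam) u1 \<and>
           critical_point T (energy T p f lam) u2 \<and>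
           critical_point T (energy T p f lam) u3 \<and>
           u1 \<noteq> u2 \<and> u1 \<noteq> u3 \<and> u2 \<noteq> u3 \<and>
           u1 \<noteq> (\<lambda>_. 0) \<and> u2 \<noteq> (\<lambda>_. 0)"
proof -
  let ?F = "primitive f"
  have contF: "continuous_on UNIV (?F k)" if "k \<in> {1..T}" for k
    using assms(6) that primitive_has_derivative
    by (meson DERIV_continuous_on DERIV_subset subset_UNIV)
  interpret discrete_dirichlet T p f
  proof
    show "\<exists>C. \<forall>t. ?F k t \<le> \<epsilon> * \<bar>t\<bar> powr p_min T p + C" if "k \<in> {1..T}" "0 < \<epsilon>" for k \<epsilon>
      using growth_bound_of_Limsup[OF _ contF that(2)] assms(9) that(1) by blast
  qed (use assms in auto)
  have le_s': "norm_sup T u \<le> s'" if u: "u \<in> H T" "mu T p u \<le> s" for u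
  proof -
    obtain R where R: "\<forall>u\<in>H T. energy T p f 0 u \<le> s \<longrightarrow> (\<forall>k. \<bar>u k\<bar> \<le> R)"
      using coercive[of 0 s] by auto
    have "norm_sup T w \<le> R" if "w \<in> H T" "mu T p w \<le> s" for w
      using R that norm_sup_attained[OF that(1) T] by (metis add.right_neutral energy_def mult_zero_left)
    then show ?thesis
      unfolding s'_def sup_radius_def using u by (intro cSup_upper bdd_aboveI[of _ R]) auto
  qed
  have r'_le: "r' \<le> norm_sup T u" if "u \<in> H T" "r \<le> mu T p u" for u
  proof -
    have "0 \<le> norm_sup T w" for w using norm_sup_ge[of 0 T w] by force
    then show ?thesis
      unfolding r'_def inf_radius_def using that by (intro cInf_lower bdd_belowI[of _ 0]) auto
  qed
  have s'_nonneg: "0 \<le> s'"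
    using le_s'[OF zero_in_H] norm_sup_ge[of 0 T "\<lambda>_. 0"] assms(7,8) by simp
  obtain M where M: "\<And>k. k \<in> {1..T} \<Longrightarrow> (SUP t\<in>{t. \<bar>t\<bar> \<le> s'}. ereal (?F k t)) = ereal (M k)"
    "\<And>k t. k \<in> {1..T} \<Longrightarrow> \<bar>t\<bar> \<le> s' \<Longrightarrow> ?F k t \<le> M k"
    using SUP_eq_maximum[OF contF s'_nonneg] by metis
  have bound: "\<bar>u k\<bar> \<le> s'" if "u \<in> H T" "mu T p u \<le> s" "k \<in> {1..T}" for u k
    using norm_sup_ge[of k T u] le_s'[OF that(1,2)] that(3) by force
  have annulus: "0 \<le> J T f u" if u: "u \<in> H T" "r \<le> mu T p u" "mu T p u \<le> s" for u
  proof -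
    obtain k where k: "k \<in> {1..T}" "\<bar>u k\<bar> = norm_sup T u" using norm_sup_attained[OF u(1) T] by blast
    have "ereal (?F k (u k)) \<le> (SUP t\<in>{t. r' \<le> \<bar>t\<bar> \<and> \<bar>t\<bar> \<le> s'}. ereal (?F k t))"
      by (rule SUP_upper) (use k(2) r'_le le_s' u in auto)
    also have "\<dots> \<le> - (\<Sum>h\<in>{1..T} - {k}. SUP t\<in>{t. \<bar>t\<bar> \<le> s'}. ereal (?F h t))"
      using assms(11) k(1) by blast
    also have "(\<Sum>h\<in>{1..T} - {k}. SUP t\<in>{t. \<bar>t\<bar> \<le> s'}. ereal (?F h t)) = (\<Sum>h\<in>{1..T} - {k}. ereal (M h))"
      by (intro sum.cong M(1)) auto
    finally have "?F k (u k) + (\<Sum>h\<in>{1..T} - {k}. M h) \<le> 0" by (simp add: sum_ereal)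
    moreover have "(\<Sum>h\<in>{1..T} - {k}. ?F h (u h)) \<le> (\<Sum>h\<in>{1..T} - {k}. M h)"
      by (intro sum_mono M(2) bound u(1,3)) auto
    moreover have "(\<Sum>h=1..T. ?F h (u h)) = ?F k (u k) + (\<Sum>h\<in>{1..T} - {k}. ?F h (u h))"
      using k(1) by (simp add: sum.remove)
    ultimately show ?thesis by (simp add: J_def)
  qed
  have ball: "- (\<Sum>k=1..T. M k) \<le> J T f u" if "u \<in> H T" "mu T p u \<le> s" for u
    unfolding J_def by (simp, intro sum_mono M(2) bound that) auto
  have "(\<Sum>k=1..T. SUP t\<in>{t. \<bar>t\<bar> \<le> s'}. ereal (?F k t)) = (\<Sum>k=1..T. ereal (M k))"
    by (intro sum.cong M(1)) auto
  then have "ereal (\<Sum>k=1..T. M k) < (\<Sum>k=1..T. SUP t\<in>UNIV. ereal (?F k t))"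
    using assms(10) by (simp add: sum_ereal)
  then obtain t where t: "(\<Sum>k=1..T. M k) < (\<Sum>k=1..T. ?F k (t k))"
    using less_sum_SUP_ereal[of "{1..T}"] by blast
  define u0 where "u0 k = (if k \<in> {1..T} then t k else 0)" for k
  have "u0 \<in> H T" by (auto simp: u0_def H_eq)
  moreover have "(\<Sum>k=1..T. ?F k (u0 k)) = (\<Sum>k=1..T. ?F k (t k))"
    by (intro sum.cong) (auto simp: u0_def)
  then have "J T f u0 < - (\<Sum>k=1..T. M k)" using t by (simp add: J_def)
  ultimately show ?thesis
    using three_critical_points[of r s "- (\<Sum>k=1..T. M k)" u0] assms(7,8) annulus ball by blast
qed
end
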